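(* (Error-aware setting.) For every low-level program $c^L$ and all assertions $\mathcal{P},\mathcal{Q}\subseteq\Sigma^L\times\Sigma^H\times\mathrm{Prog}^H$, the relational Hoare triple $\langle\mathcal{P}\rangle\,c^L\,\langle\mathcal{Q}\rangle$ is valid if and only if for every $X\subseteq\Sigma^H$ the standard Hoare triple $\{\mathrm{enc}_X(\mathcal{P})\}\,c^L\,\{\mathrm{enc}_X(\mathcal{Q})\}$ is $\forall$-valid, where validity of both kinds of triples and the encoding are the error-aware versions.
   Context: $\Sigma^L,\Sigma^H$ are sets of low-level and high-level states and $\mathrm{Prog}^L,\mathrm{Prog}^H$ sets of programs. Each program $c$ over states $\Sigma$ has a denotational semantics with two components: $[\![c]\!]_{\mathsf{nrm}}\subseteq\Sigma\times\Sigma$ ($(\sigma,\sigma')$ is in it if executing $c$ from $\sigma$ may terminate at $\sigma'$) and $[\![c]\!]_{\mathsf{err}}\subseteq\Sigma$ ($\sigma$ is in it if executing $c$ from $\sigma$ may result in an error). Assertions are sets; $s\models P$ means $s\in P$. Configuration refinement: $(\sigma_1,c_1)\hookrightarrow(\sigma_2,c_2)$ iff (i) for all $\sigma_3$, $(\sigma_2,\sigma_3)\in[\![c_2]\!]_{\mathsf{nrm}}$ implies $(\sigma_1,\sigma_3)\in[\![c_1]\!]_{\mathsf{nrm}}$, and (ii) $\sigma_2\in[\![c_2]\!]_{\mathsf{err}}$ implies $\sigma_1\in[\![c_1]\!]_{\mathsf{err}}$. Standard triple: $\{P\}\,c\,\{Q\}$ is $\forall$-valid if for every $\sigma_1\models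 P$: $\sigma_1\notin[\![c]\!]_{\mathsf{err}}$, and for all $\sigma_2$, $(\sigma_1,\sigma_2)\in[\![c]\!]_{\mathsf{nrm}}$ implies $\sigma_2\models Q$. Relational triple: $\langle\mathcal{P}\rangle\,c^L\,\langle\mathcal{Q}\rangle$ is valid if for every $(\sigma^L_1,\sigma^H_1,c^H_1)\models\mathcal{P}$: (error simulation) if $\sigma^L_1\in[\![c^L]\!]_{\mathsf{err}}$ then $\sigma^H_1\in[\![c^H_1]\!]_{\mathsf{err}}$; and (result simulation) for every $\sigma^L_2$ with $(\sigma^L_1,\sigma^L_2)\in[\![c^L]\!]_{\mathsf{nrm}}$, either $\sigma^H_1\in[\![c^H_1]\!]_{\mathsf{err}}$, or there exist $\sigma^H_2,c^H_2$ with $(\sigma^H_1,c^H_1)\hookrightarrow(\sigma^H_2,c^H_2)$ and $(\sigma^L_2,\sigma^H_2,c^H_2)\models\mathcal{Q}$. Weakest precondition: $\sigma\models\mathrm{wlp}(c,X)$ iff $\sigma\notin[\![c]\!]_{\mathsf{err}}$ and for all $\sigma_0$, $(\sigma,\sigma_0)\in[\![c]\!]_{\mathsf{nrm}}$ implies $\sigma_0\in X$. Encoding: for $X\subseteq\Sigma^H$, $\sigma^L\models\mathrm{enc}_X(\mathcal{P})$ iff there exist $\sigma^H\in\Sigma^H$, $c^H\in\mathrm{Prog}^H$ with $(\sigma^L,\sigma^H,c^H)\models\mathcal{P}$ and $\sigma^H\models\mathrm{wlp}(c^H,X)$. *)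

theory Defs
  imports Main
begin

text \<open>
  The denotation of a program over states \<open>'s\<close>. Programs themselves are elements of an
  arbitrary type equipped with a semantics \<open>'p \<Rightarrow> 's denot\<close>, so that assertions can
  distinguish programs having the same denotation.
\<close>

record 's denot =
  nrm :: "('s \<times> 's) set"
  err :: "'s set"

definition config_refines ::
  "('p \<Rightarrow> 's denot) \<Rightarrow> 's \<times> 'p \<Rightarrow> 's \<times> 'p \<Rightarrow> bool" where
  "config_refines sem = (\<lambda>(s1, c1) (s2, c2).
     (\<forall>s3. (s2, s3) \<in> nrm (sem c2) \<longrightarrow> (s1, s3) \<in> nrm (sem c1)) \<and>
     (s2 \<in> err (sem c2) \<longrightarrow> s1 \<in> err (sem c1)))"

definition hoare_valid ::
  "('p \<Rightarrow> 's denot) \<Rightarrow> 's set \<Rightarrow> 'p \<Rightarrow> 's set \<Rightarrow> bool" where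
  "hoare_valid sem P c Q \<longleftrightarrow>
     (\<forall>s1 \<in> P. s1 \<notin> err (sem c) \<and> (\<forall>s2. (s1, s2) \<in> nrm (sem c) \<longrightarrow> s2 \<in> Q))"

definition rel_valid ::
  "('pl \<Rightarrow> 'sl denot) \<Rightarrow> ('ph \<Rightarrow> 'sh denot) \<Rightarrow>
   ('sl \<times> 'sh \<times> 'ph) set \<Rightarrow> 'pl \<Rightarrow> ('sl \<times> 'sh \<times> 'ph) set \<Rightarrow> bool" where
  "rel_valid semL semH P cL Q \<longleftrightarrow>
     (\<forall>sL1 sH1 cH1. (sL1, sH1, cH1) \<in> P \<longrightarrow>
        (sL1 \<in> err (semL cL) \<longrightarrow> sH1 \<in> err (semH cH1)) \<and>
        (\<forall>sL2. (sL1, sL2) \<in> nrm (semL cL) \<longrightarrow>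
           sH1 \<in> err (semH cH1) \<or>
           (\<exists>sH2 cH2. config_refines semH (sH1, cH1) (sH2, cH2) \<and> (sL2, sH2, cH2) \<in> Q)))"

definition wlp :: "('p \<Rightarrow> 's denot) \<Rightarrow> 'p \<Rightarrow> 's set \<Rightarrow> 's set" where
  "wlp sem c X = {s. s \<notin> err (sem c) \<and> (\<forall>s0. (s, s0) \<in> nrm (sem c) \<longrightarrow> s0 \<in> X)}"

definition enc ::
  "('ph \<Rightarrow> 'sh denot) \<Rightarrow> 'sh set \<Rightarrow> ('sl \<times> 'sh \<times> 'ph) set \<Rightarrow> 'sl set" where
  "enc semH X P = {sL. \<exists>sH cH. (sL, sH, cH) \<in> P \<and> sH \<in> wlp semH cH X}"

end

theory Submission imports Defs begin

text \<open>
  Membership in a weakest precondition is inherited along configuration refinement, which gives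
  the forward direction. Conversely, an error-free configuration \<open>(s, c)\<close> satisfies
  \<open>wlp c X\<close> for \<open>X\<close> the set of its own outcomes, and any configuration satisfying the weakest
  precondition of this particular \<open>X\<close> is refined from \<open>(s, c)\<close>; so instantiating the standard
  triple with it recovers the relational triple.
\<close>

lemma wlp_config_refines:
  assumes "config_refines sem (s1, c1) (s2, c2)" and "s1 \<in> wlp sem c1 X"
  shows "s2 \<in> wlp sem c2 X"
  using assms by (auto simp: config_refines_def wlp_def)

lemma wlp_outcomes:
  assumes "s \<notin> err (sem c)"
  shows "s \<in> wlp sem c (nrm (sem c) `` {s})"
  using assms by (simp add: wlp_def)

text \<open>The error clause of refinement is vacuous here, since \<open>wlp\<close> already
  excludes an error at \<open>s2\<close>.\<close>

lemma config_refines_if_wlp_outcomes: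
  assumes "s2 \<in> wlp sem c2 (nrm (sem c1) `` {s1})"
  shows "config_refines sem (s1, c1) (s2, c2)"
  using assms by (simp add: config_refines_def wlp_def)

theorem theoremD1:
  fixes semL :: "'pl \<Rightarrow> 'sl denot"
    and semH :: "'ph \<Rightarrow> 'sh denot"
    and cL :: 'pl
    and P Q :: "('sl \<times> 'sh \<times> 'ph) set"
  shows "rel_valid semL semH P cL Q \<longleftrightarrow>
         (\<forall>X :: 'sh set. hoare_valid semL (enc semH X P) cL (enc semH X Q))"
proof
  assume rel: "rel_valid semL semH P cL Q"
  show "\<forall>X. hoare_valid semL (enc semH X P) cL (enc semH X Q)"
    unfolding hoare_valid_def
  proof (intro allI ballI)
    fix X sL1
    assume "sL1 \<in> enc semH X P"
    then obtain sH cH where P: "(sL1, sH, cH) \<in> P" and w: "sH \<in> wlp semH cH X"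
      by (auto simp: enc_def)
    \<comment> \<open>Safety closes the error escape in result simulation and, by contraposition of
      error simulation, makes \<open>cL\<close> safe at \<open>sL1\<close>.\<close>
    from w have safe: "sH \<notin> err (semH cH)"
      by (simp add: wlp_def)
    have "sL1 \<notin> err (semL cL)"
      using rel P safe unfolding rel_valid_def by blast
    moreover have "sL2 \<in> enc semH X Q" if step: "(sL1, sL2) \<in> nrm (semL cL)" for sL2
    proof -
      obtain sH2 cH2 where "config_refines semH (sH, cH) (sH2, cH2)" "(sL2, sH2, cH2) \<in> Q"
        using rel P safe step unfolding rel_valid_def by blast
      with w show ?thesis
        by (auto simp: enc_def dest: wlp_config_refines)
    qed
    ultimately show "sL1 \<notin> err (semL cL) \<and>
        (\<forall>sL2. (sL1, sL2) \<in> nrm (semL cL) \<longrightarrow> sL2 \<in> enc semH X Q)"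
      by blast
  qed
next
  assume std: "\<forall>X. hoare_valid semL (enc semH X P) cL (enc semH X Q)"
  \<comment> \<open>The error-free case suffices: an error at \<open>sH1\<close> satisfies both
    clauses of \<open>rel_valid\<close> at once.\<close>
  have "sL1 \<notin> err (semL cL) \<and> (\<forall>sL2. (sL1, sL2) \<in> nrm (semL cL) \<longrightarrow>
      (\<exists>sH2 cH2. config_refines semH (sH1, cH1) (sH2, cH2) \<and> (sL2, sH2, cH2) \<in> Q))"
    if P: "(sL1, sH1, cH1) \<in> P" and safe: "sH1 \<notin> err (semH cH1)" for sL1 sH1 cH1
  proof -
    \<comment> \<open>\<open>?X\<close> depends only on the high-level configuration, so one
      instance of \<open>std\<close> serves every \<open>sL2\<close>.\<close>
    let ?X = "nrm (semH cH1) `` {sH1}"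
    have "sL1 \<in> enc semH ?X P"
      using P wlp_outcomes[of sH1 semH cH1, OF safe] unfolding enc_def by blast
    then have "sL1 \<notin> err (semL cL) \<and>
        (\<forall>sL2. (sL1, sL2) \<in> nrm (semL cL) \<longrightarrow> sL2 \<in> enc semH ?X Q)"
      using std unfolding hoare_valid_def by blast
    then show ?thesis
      unfolding enc_def using config_refines_if_wlp_outcomes[of _ semH _ cH1 sH1] by blast
  qed
  then show "rel_valid semL semH P cL Q"
    unfolding rel_valid_def by blast
qed

end
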